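(* Let $a$ be a fixed non-negative integer. Then $\mathbb{E}[\mathbf{Z}_n^a]\to\mathbb{E}[\mathbf{Z}^a]$ as $n\to\infty$. In particular, if $\pi\in\mathfrak{S}_n$ is chosen uniformly, then \[ \mathbb{E}[\mathrm{mj}(\pi)]\to\sum_{d=0}^{\infty}e^{-2d}\quad(\approx1.15652) \] as $n\to\infty$.
   Context: For $\pi\in\mathfrak{S}_n$, $\mathrm{mj}(\pi)=\min_{1\le i\le n-1}|\pi(i+1)-\pi(i)|$. $\mathbf{Z}_n$ is the random variable $\mathrm{mj}(\pi)$ for $\pi\in\mathfrak{S}_n$ uniform. $\mathbf{Z}$ is the integer-valued random variable with $\Pr{\mathbf{Z}\ge d+1}=e^{-2d}$ for every integer $d\ge0$. *)

theory Defs
  imports "HOL-Analysis.Analysis" "HOL-Probability.Probability" "HOL-Combinatorics.Permutations"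
begin

definition mj :: "nat \<Rightarrow> (nat \<Rightarrow> nat) \<Rightarrow> nat" where
  "mj n \<pi> = Min ((\<lambda>i. nat \<bar>int (\<pi> (i + 1)) - int (\<pi> i)\<bar>) ` {1..n - 1})"

definition Zn_moment :: "nat \<Rightarrow> nat \<Rightarrow> real" where
  "Zn_moment a n = measure_pmf.expectation (pmf_of_set {\<pi>. \<pi> permutes {1..n}})
                      (\<lambda>\<pi>. real (mj n \<pi>) ^ a)"

text \<open>Point probabilities of Z, derived from Pr(Z >= d+1) = exp(-2d) for d >= 0:
  Pr(Z = 0) = 1 - Pr(Z >= 1) = 0, and Pr(Z = d) = exp(-2(d-1)) - exp(-2d) for d >= 1.\<close>
definition Z_prob :: "nat \<Rightarrow> real" where
  "Z_prob d = (if d = 0 then 0 else exp (-2 * real (d - 1)) - exp (-2 * real d))"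

definition Z_moment :: "nat \<Rightarrow> real" where
  "Z_moment a = (\<Sum>d. real d ^ a * Z_prob d)"

end

theory Submission
  imports Defs "HOL-Real_Asymp.Real_Asymp"
begin

text \<open>
  Fix \<open>d\<close> and let \<open>N(\<pi>)\<close> be the number of positions \<open>p < n\<close> with \<open>\<bar>\<pi>(p + 1) - \<pi>(p)\<bar> \<le> d\<close>, so that
  \<open>mj(\<pi>) > d\<close> iff \<open>N(\<pi>) = 0\<close>. Since \<open>\<pi> \<mapsto> \<pi>' = \<pi> \<circ> (p q)\<close> is a bijection, for every \<open>f\<close> the sum of
  \<open>n N(\<pi>) f(N(\<pi>))\<close> over all \<open>\<pi>\<close> equals the sum of \<open>f(N(\<pi>'))\<close> over all \<open>(\<pi>, p, q)\<close> for which \<open>p\<close> is a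
  close position of \<open>\<pi>'\<close>. For each \<open>\<pi>\<close> there are \<open>2dn + O(1) + N(\<pi>)\<close> such pairs \<open>(p, q)\<close>, and
  \<open>N(\<pi>') = N(\<pi>) + 1\<close> for all but \<open>O(1)\<close> of them on average. Hence
  \<open>E[N f(N)] - 2d E[f(N + 1)] = O(1/n)\<close> for bounded \<open>f\<close>, and taking for \<open>f\<close> the solution of Stein's
  equation for the Poisson law gives \<open>Pr(N = 0) \<rightarrow> exp(-2d)\<close>.

  The same identity with \<open>N(\<pi>') \<le> N(\<pi>) + 4\<close> yields \<open>d Pr(N \<le> k) \<le> 2 (k + 4) Pr(N \<le> k + 4)\<close>; iterating
  it bounds \<open>Pr(mj > d)\<close> by \<open>C d\<^sup>-\<^sup>r\<close> uniformly in \<open>n\<close>, for every \<open>r\<close>. The moments therefore converge by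
  dominated convergence (Tannery) and summation by parts.
\<close>

subsection \<open>Close pairs of values\<close>

text \<open>Written with additions, so that truncated subtraction on naturals never enters. Because
  of \<open>x \<noteq> y\<close>, the index \<open>q = Suc p\<close> contributes 0 when every
  \<open>\<pi> q\<close> is compared with \<open>\<pi> (Suc p)\<close>.\<close>

definition close :: "nat \<Rightarrow> nat \<Rightarrow> nat \<Rightarrow> bool" where
  "close d x y \<longleftrightarrow> x \<noteq> y \<and> x \<le> y + d \<and> y \<le> x + d"

definition close_pos :: "nat \<Rightarrow> nat \<Rightarrow> (nat \<Rightarrow> nat) \<Rightarrow> nat set" where
  "close_pos d n \<pi> = {p \<in> {1..<n}. close d (\<pi> p) (\<pi> (Suc p))}"

definition num_close :: "nat \<Rightarrow> nat \<Rightarrow> (nat \<Rightarrow> nat) \<Rightarrow> nat" where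
  "num_close d n \<pi> = card (close_pos d n \<pi>)"

definition close_deg :: "nat \<Rightarrow> nat \<Rightarrow> nat \<Rightarrow> nat" where
  "close_deg d n x = card {y \<in> {1..n}. close d y x}"

abbreviation perms :: "nat \<Rightarrow> (nat \<Rightarrow> nat) set" where
  "perms n \<equiv> {\<pi>. \<pi> permutes {1..n}}"

abbreviation swap :: "(nat \<Rightarrow> nat) \<Rightarrow> nat \<Rightarrow> nat \<Rightarrow> nat \<Rightarrow> nat" where
  "swap \<pi> p q \<equiv> \<pi> \<circ> Transposition.transpose p q"

lemma close_sym: "close d x y \<longleftrightarrow> close d y x"
  by (auto simp: close_def)

lemma finite_close_pos [simp]: "finite (close_pos d n \<pi>)"
  by (simp add: close_pos_def)

lemma finite_perms [simp]: "finite (perms n)"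
  by (simp add: finite_permutations)

lemma card_perms: "card {\<pi>. \<pi> permutes {Suc 0..n}} = fact n"
  by (simp add: card_permutations)

lemma sum_close_pos:
  "(\<Sum>p\<in>{1..<n}. of_bool (p \<in> close_pos d n \<pi>)) = real (num_close d n \<pi>)"
proof -
  have "{1..<n} \<inter> {p. p \<in> close_pos d n \<pi>} = close_pos d n \<pi>"
    by (auto simp: close_pos_def)
  then show ?thesis
    by (simp add: num_close_def)
qed

lemma close_deg_le: "close_deg d n x \<le> 2 * d"
proof -
  have "{y \<in> {1..n}. close d y x} \<subseteq> {x - d..x + d} - {x}"
    by (auto simp: close_def)
  then have "close_deg d n x \<le> card ({x - d..x + d} - {x})"
    unfolding close_deg_def by (intro card_mono) auto
  also have "\<dots> \<le> 2 * d" by simp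
  finally show ?thesis .
qed

text \<open>The \<open>d\<close> values above \<open>x\<close> suffice unless they run past
  \<open>n\<close>. In that case all values above \<open>x\<close> are joined with up to
  \<open>d\<close> values below it, and \<open>d < n\<close> makes these at least \<open>d\<close>
  in number.\<close>

lemma close_deg_ge:
  assumes "d < n" "x \<in> {1..n}"
  shows "d \<le> close_deg d n x"
proof (cases "x + d \<le> n")
  case True
  then have "{x<..x + d} \<subseteq> {y \<in> {1..n}. close d y x}"
    by (auto simp: close_def)
  then have "card {x<..x + d} \<le> close_deg d n x"
    unfolding close_deg_def by (intro card_mono) auto
  then show ?thesis by simp
next
  case False
  define l where "l = max 1 (x - d)"
  have "{l..<x} \<union> {x<..n} \<subseteq> {y \<in> {1..n}. close d y x}"
    using False assms by (auto simp: close_def l_def)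
  then have "card ({l..<x} \<union> {x<..n}) \<le> close_deg d n x"
    unfolding close_deg_def by (intro card_mono) auto
  moreover have "card ({l..<x} \<union> {x<..n}) = (x - l) + (n - x)"
    by (subst card_Un_disjoint) auto
  moreover have "d \<le> (x - l) + (n - x)" using assms by (auto simp: l_def)
  ultimately show ?thesis by simp
qed

lemma close_deg_middle:
  assumes "d < x" "x + d \<le> n"
  shows "close_deg d n x = 2 * d"
proof -
  have "{y \<in> {1..n}. close d y x} = {x - d..x + d} - {x}"
    using assms by (auto simp: close_def)
  then show ?thesis using assms by (simp add: close_deg_def)
qed

text \<open>Only the \<open>n - 2 * d\<close> values whose whole window of radius \<open>d\<close>
  lies in \<open>{1..n}\<close> are counted. For \<open>n < 2 * d\<close> the left side is not
  positive.\<close>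

lemma sum_close_deg_ge: "2 * real d * (real n - 2 * real d) \<le> (\<Sum>x\<in>{1..n}. real (close_deg d n x))"
proof (cases "2 * d \<le> n")
  case True
  have "2 * real d * (real n - 2 * real d) = (\<Sum>x\<in>{d+1..n-d}. 2 * real d)"
    using True by (simp add: of_nat_diff algebra_simps)
  also have "\<dots> = (\<Sum>x\<in>{d+1..n-d}. real (close_deg d n x))"
    by (intro sum.cong refl) (subst close_deg_middle, auto)
  also have "\<dots> \<le> (\<Sum>x\<in>{1..n}. real (close_deg d n x))"
    by (intro sum_mono2) auto
  finally show ?thesis .
next
  case False
  then have "2 * real d * (real n - 2 * real d) \<le> 0"
    by (intro mult_nonneg_nonpos) auto
  also have "\<dots> \<le> (\<Sum>x\<in>{1..n}. real (close_deg d n x))"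
    by (intro sum_nonneg) auto
  finally show ?thesis .
qed

subsection \<open>Exchange by transpositions\<close>

text \<open>For fixed \<open>p\<close> and \<open>q\<close>, composing with the transposition
  permutes \<open>perms n\<close>; the sums are reordered so that the one over \<open>\<pi>\<close>
  is innermost.\<close>

lemma sum_perms_swap:
  fixes G :: "(nat \<Rightarrow> nat) \<Rightarrow> nat \<Rightarrow> nat \<Rightarrow> real"
  shows "(\<Sum>\<pi>\<in>perms n. \<Sum>p\<in>{1..<n}. \<Sum>q\<in>{1..n}. G (swap \<pi> p q) p q)
       = (\<Sum>\<pi>\<in>perms n. \<Sum>p\<in>{1..<n}. \<Sum>q\<in>{1..n}. G \<pi> p q)"
proof -
  have *: "(\<Sum>\<pi>\<in>perms n. G (swap \<pi> p q) p q) = (\<Sum>\<pi>\<in>perms n. G \<pi> p q)"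
    if "p \<in> {1..<n}" "q \<in> {1..n}" for p q
    using that
    by (intro sum_permutations_compose_right[symmetric] permutes_swap_id) auto
  have "(\<Sum>\<pi>\<in>perms n. \<Sum>p\<in>{1..<n}. \<Sum>q\<in>{1..n}. G (swap \<pi> p q) p q)
      = (\<Sum>p\<in>{1..<n}. \<Sum>q\<in>{1..n}. \<Sum>\<pi>\<in>perms n. G (swap \<pi> p q) p q)"
    by (subst sum.swap, rule sum.cong[OF refl], rule sum.swap)
  also have "\<dots> = (\<Sum>p\<in>{1..<n}. \<Sum>q\<in>{1..n}. \<Sum>\<pi>\<in>perms n. G \<pi> p q)"
    by (intro sum.cong refl *)
  also have "\<dots> = (\<Sum>\<pi>\<in>perms n. \<Sum>p\<in>{1..<n}. \<Sum>q\<in>{1..n}. G \<pi> p q)"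
    by (rule sym, subst sum.swap, rule sum.cong[OF refl], rule sum.swap)
  finally show ?thesis .
qed

text \<open>The swap brings \<open>\<pi> q\<close> to position \<open>p\<close> and leaves
  \<open>\<pi> (Suc p)\<close> in place. For \<open>q = Suc p\<close> the two entries trade places,
  and closeness is symmetric.\<close>

lemma close_pos_swap_iff:
  assumes "p \<in> {1..<n}"
  shows "p \<in> close_pos d n (swap \<pi> p q) \<longleftrightarrow>
         (if q = Suc p then p \<in> close_pos d n \<pi> else close d (\<pi> q) (\<pi> (Suc p)))"
  using assms by (auto simp: close_pos_def Transposition.transpose_def close_sym)

lemma sum_perm_close:
  assumes "\<pi> permutes {1..n}"
  shows "(\<Sum>q\<in>{1..n}. of_bool (close d (\<pi> q) x)) = real (close_deg d n x)"
proof -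
  have "(\<Sum>q\<in>{1..n}. of_bool (close d (\<pi> q) x)) = (\<Sum>y\<in>{1..n}. of_bool (close d y x) :: real)"
    using sum.permute[OF assms, of "\<lambda>y. of_bool (close d y x) :: real"] by (simp add: o_def)
  also have "\<dots> = real (close_deg d n x)"
    by (simp add: close_deg_def Int_def)
  finally show ?thesis .
qed

text \<open>As \<open>q\<close> varies, \<open>\<pi> q\<close> runs through all values once, which
  gives the degree of \<open>\<pi> (Suc p)\<close>. The exceptional index \<open>q = Suc p\<close>
  adds 0 there and is accounted for by the last summand.\<close>

lemma sum_q_close_pos_swap:
  assumes "\<pi> permutes {1..n}" "p \<in> {1..<n}"
  shows "(\<Sum>q\<in>{1..n}. of_bool (p \<in> close_pos d n (swap \<pi> p q)))
       = real (close_deg d n (\<pi> (Suc p))) + of_bool (p \<in> close_pos d n \<pi>)"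
proof -
  have "(\<Sum>q\<in>{1..n}. of_bool (p \<in> close_pos d n (swap \<pi> p q)) :: real)
      = (\<Sum>q\<in>{1..n}. of_bool (close d (\<pi> q) (\<pi> (Suc p)))
           + (if q = Suc p then of_bool (p \<in> close_pos d n \<pi>) else 0))"
    using assms(2) by (intro sum.cong refl) (subst close_pos_swap_iff, auto simp: close_def)
  also have "\<dots> = real (close_deg d n (\<pi> (Suc p))) + of_bool (p \<in> close_pos d n \<pi>)"
    unfolding sum.distrib sum_perm_close[OF assms(1)] using assms(2) by simp
  finally show ?thesis .
qed

text \<open>Now \<open>q\<close> is fixed: the value \<open>\<pi> q\<close> has at most
  \<open>2 * d\<close> close partners \<open>\<pi> (Suc p)\<close>, and the exceptional position
  \<open>p = q - 1\<close> accounts for the extra 1.\<close>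

lemma sum_p_close_pos_swap_le:
  assumes "\<pi> permutes {1..n}"
  shows "(\<Sum>p\<in>{1..<n}. of_bool (p \<in> close_pos d n (swap \<pi> p q))) \<le> 2 * real d + 1"
proof -
  have "(\<Sum>p\<in>{1..<n}. of_bool (p \<in> close_pos d n (swap \<pi> p q)) :: real)
      \<le> (\<Sum>p\<in>{1..<n}. of_bool (close d (\<pi> (Suc p)) (\<pi> q)) + (if p = q - 1 then 1 else 0))"
    by (intro sum_mono) (subst close_pos_swap_iff, auto simp: close_sym)
  also have "\<dots> \<le> (\<Sum>p\<in>{1..<n}. of_bool (close d (\<pi> (Suc p)) (\<pi> q))) + 1"
    by (simp add: sum.distrib del: sum_of_bool_eq)
  also have "(\<Sum>p\<in>{1..<n}. of_bool (close d (\<pi> (Suc p)) (\<pi> q)) :: real)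
      = (\<Sum>j\<in>{2..<Suc n}. of_bool (close d (\<pi> j) (\<pi> q)))"
    by (subst sum.shift_bounds_Suc_ivl[symmetric]) (simp add: numeral_2_eq_2 del: sum_of_bool_eq)
  also have "\<dots> \<le> (\<Sum>j\<in>{1..n}. of_bool (close d (\<pi> j) (\<pi> q)))"
    by (intro sum_mono2) auto
  also have "\<dots> \<le> 2 * real d"
    using close_deg_le[of d n "\<pi> q"] unfolding sum_perm_close[OF assms] by linarith
  finally show ?thesis by this simp_all
qed

lemma sum_pq_close_pos_swap:
  assumes "\<pi> permutes {1..n}"
  shows "(\<Sum>p\<in>{1..<n}. \<Sum>q\<in>{1..n}. of_bool (p \<in> close_pos d n (swap \<pi> p q)))
       = (\<Sum>p\<in>{1..<n}. real (close_deg d n (\<pi> (Suc p)))) + num_close d n \<pi>"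
proof -
  have "(\<Sum>p\<in>{1..<n}. \<Sum>q\<in>{1..n}. of_bool (p \<in> close_pos d n (swap \<pi> p q)) :: real)
      = (\<Sum>p\<in>{1..<n}. real (close_deg d n (\<pi> (Suc p))) + of_bool (p \<in> close_pos d n \<pi>))"
    using assms by (intro sum.cong refl sum_q_close_pos_swap) auto
  then show ?thesis by (simp only: sum.distrib sum_close_pos)
qed

lemma sum_deg_le: "(\<Sum>p\<in>{1..<n}. real (close_deg d n (\<pi> (Suc p)))) \<le> 2 * real d * real n"
proof -
  have "(\<Sum>p\<in>{1..<n}. real (close_deg d n (\<pi> (Suc p)))) \<le> (\<Sum>p\<in>{1..<n}. 2 * real d)"
    using close_deg_le by (intro sum_mono) (metis of_nat_le_iff of_nat_mult of_nat_numeral)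
  also have "\<dots> \<le> 2 * real d * real n" by (simp add: mult.commute[of _ "real d"] mult_left_mono)
  finally show ?thesis .
qed

text \<open>Each degree is bounded below by \<open>d\<close> only, half of its typical value, but
  for every \<open>d < n\<close>. This uniformity in \<open>d\<close> serves the tail bound.\<close>

lemma sum_deg_ge:
  assumes "\<pi> permutes {1..n}" "d < n"
  shows "real d * (real n - 1) \<le> (\<Sum>p\<in>{1..<n}. real (close_deg d n (\<pi> (Suc p))))"
proof -
  have "real d * (real n - 1) = (\<Sum>p\<in>{1..<n}. real d)"
    using assms by (simp add: of_nat_diff)
  also have "\<dots> \<le> (\<Sum>p\<in>{1..<n}. real (close_deg d n (\<pi> (Suc p))))"
  proof (intro sum_mono)
    fix p assume "p \<in> {1..<n}"
    then have "Suc p \<in> {1..n}" by auto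
    then have "\<pi> (Suc p) \<in> {1..n}" using permutes_in_image[OF assms(1)] by metis
    then show "real d \<le> real (close_deg d n (\<pi> (Suc p)))"
      using close_deg_ge[OF assms(2)] by simp
  qed
  finally show ?thesis .
qed

text \<open>Sharp up to a constant for fixed \<open>d\<close>: the loss consists of
  \<open>4 * d\<^sup>2\<close> from values near the ends of the range and \<open>2 * d\<close> from
  \<open>\<pi> 1\<close>, which is no \<open>\<pi> (Suc p)\<close>.\<close>

lemma sum_deg_ge_2d:
  assumes "\<pi> permutes {1..n}"
  shows "2 * real d * real n - 2 * real d * (2 * real d + 1)
       \<le> (\<Sum>p\<in>{1..<n}. real (close_deg d n (\<pi> (Suc p))))"
proof (cases "n = 0")
  case True
  then show ?thesis by simp
next
  case False
  have "2 * real d * (real n - 2 * real d) \<le> (\<Sum>x\<in>{1..n}. real (close_deg d n x))"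
    by (rule sum_close_deg_ge)
  also have "\<dots> = (\<Sum>x\<in>{1..n}. real (close_deg d n (\<pi> x)))"
    using sum.permute[OF assms, of "\<lambda>x. real (close_deg d n x)"] by (simp add: o_def)
  also have "\<dots> = real (close_deg d n (\<pi> 1)) + (\<Sum>x\<in>{Suc 1..<Suc n}. real (close_deg d n (\<pi> x)))"
    using False sum.atLeast_Suc_atMost[of 1 n "\<lambda>x. real (close_deg d n (\<pi> x))"]
    by (simp add: atLeastLessThanSuc_atLeastAtMost)
  also have "(\<Sum>x\<in>{Suc 1..<Suc n}. real (close_deg d n (\<pi> x)))
      = (\<Sum>p\<in>{1..<n}. real (close_deg d n (\<pi> (Suc p))))"
    by (rule sum.shift_bounds_Suc_ivl)
  also have "real (close_deg d n (\<pi> 1)) \<le> 2 * real d"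
    using close_deg_le[of d n "\<pi> 1"] by linarith
  finally show ?thesis by (simp add: algebra_simps)
qed

section \<open>Effect of one transposition on the close positions\<close>

lemma close_pos_swap_far:
  assumes "j \<notin> {p - 1, p, q - 1, q}"
  shows "j \<in> close_pos d n (swap \<pi> p q) \<longleftrightarrow> j \<in> close_pos d n \<pi>"
proof -
  have "j \<noteq> p" "j \<noteq> q" "Suc j \<noteq> p" "Suc j \<noteq> q" using assms by auto
  then show ?thesis by (simp add: close_pos_def Transposition.transpose_def)
qed

lemma num_close_swap_le: "num_close d n (swap \<pi> p q) \<le> num_close d n \<pi> + 4"
proof -
  have "close_pos d n (swap \<pi> p q) \<subseteq> close_pos d n \<pi> \<union> {p - 1, p, q - 1, q}"
    using close_pos_swap_far by blast
  then have "num_close d n (swap \<pi> p q) \<le> card (close_pos d n \<pi> \<union> {p - 1, p, q - 1, q})"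
    unfolding num_close_def by (intro card_mono) auto
  also have "\<dots> \<le> num_close d n \<pi> + card {p - 1, p, q - 1, q}"
    unfolding num_close_def by (rule card_Un_le)
  also have "card {p - 1, p, q - 1, q} \<le> 4"
    by (simp add: card_insert_if)
  finally show ?thesis by simp
qed

text \<open>Only positions reading an exchanged entry can change status. If none of these was close
  before and only \<open>p\<close> is close afterwards, the set of close positions gains exactly
  \<open>p\<close>.\<close>

lemma num_close_swap_eq:
  assumes "p \<in> close_pos d n (swap \<pi> p q)"
    and "{p - 1, p, q - 1, q} \<inter> close_pos d n \<pi> = {}"
    and "{p - 1, q - 1, q} \<inter> close_pos d n (swap \<pi> p q) \<subseteq> {p}"
  shows "num_close d n (swap \<pi> p q) = num_close d n \<pi> + 1"
proof -
  have "close_pos d n (swap \<pi> p q) = insert p (close_pos d n \<pi>)"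
  proof (intro set_eqI iffI)
    fix j
    show "j \<in> insert p (close_pos d n \<pi>)" if "j \<in> close_pos d n (swap \<pi> p q)"
      using that assms close_pos_swap_far[of j p q d n \<pi>] by blast
    show "j \<in> close_pos d n (swap \<pi> p q)" if "j \<in> insert p (close_pos d n \<pi>)"
      using that assms close_pos_swap_far[of j p q d n \<pi>] by blast
  qed
  moreover have "p \<notin> close_pos d n \<pi>" using assms(2) by blast
  ultimately show ?thesis by (simp add: num_close_def)
qed

text \<open>Double counting: each close position \<open>p\<close> of \<open>\<pi>\<close> can be
  paired with all \<open>n\<close> indices \<open>q\<close>, and \<open>sum_perms_swap\<close> moves
  the count to the swapped permutations.\<close>

lemma sum_perms_exchange:
  fixes h :: "(nat \<Rightarrow> nat) \<Rightarrow> real"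
  shows "(\<Sum>\<pi>\<in>perms n. real n * real (num_close d n \<pi>) * h \<pi>)
       = (\<Sum>\<pi>\<in>perms n. \<Sum>p\<in>{1..<n}. \<Sum>q\<in>{1..n}.
            of_bool (p \<in> close_pos d n (swap \<pi> p q)) * h (swap \<pi> p q))"
proof -
  have "(\<Sum>\<pi>\<in>perms n. \<Sum>p\<in>{1..<n}. \<Sum>q\<in>{1..n}.
            of_bool (p \<in> close_pos d n (swap \<pi> p q)) * h (swap \<pi> p q))
      = (\<Sum>\<pi>\<in>perms n. \<Sum>p\<in>{1..<n}. \<Sum>q\<in>{1..n}. of_bool (p \<in> close_pos d n \<pi>) * h \<pi>)"
    by (rule sum_perms_swap)
  also have "\<dots> = (\<Sum>\<pi>\<in>perms n. real n * ((\<Sum>p\<in>{1..<n}. of_bool (p \<in> close_pos d n \<pi>)) * h \<pi>))"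
    by (simp add: sum_distrib_left sum_distrib_right del: sum_of_bool_eq sum_of_bool_mult_eq)
  also have "\<dots> = (\<Sum>\<pi>\<in>perms n. real n * real (num_close d n \<pi>) * h \<pi>)"
    by (simp only: sum_close_pos mult.assoc)
  finally show ?thesis by (rule sym)
qed

text \<open>The exchange identity with constant weight bounds \<open>n * ?X\<close> by a main term
  plus \<open>?X\<close> itself. Absorbing \<open>?X\<close> leaves the factor \<open>n - 1\<close>,
  and \<open>n \<le> 2 * (n - 1)\<close>.\<close>

lemma sum_num_close_le:
  assumes "n \<ge> 2"
  shows "(\<Sum>\<pi>\<in>perms n. real (num_close d n \<pi>)) \<le> 4 * real d * fact n"
proof -
  let ?X = "\<Sum>\<pi>\<in>perms n. real (num_close d n \<pi>)"
  have "real n * ?X = (\<Sum>\<pi>\<in>perms n. \<Sum>p\<in>{1..<n}. \<Sum>q\<in>{1..n}.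
            of_bool (p \<in> close_pos d n (swap \<pi> p q)))"
    using sum_perms_exchange[where h = "\<lambda>_. 1" and d = d and n = n]
    by (simp add: sum_distrib_left del: sum_of_bool_eq)
  also have "\<dots> \<le> (\<Sum>\<pi>\<in>perms n. 2 * real d * real n + real (num_close d n \<pi>))"
  proof (rule sum_mono)
    fix \<pi> assume "\<pi> \<in> perms n"
    then show "(\<Sum>p\<in>{1..<n}. \<Sum>q\<in>{1..n}. of_bool (p \<in> close_pos d n (swap \<pi> p q)))
        \<le> 2 * real d * real n + real (num_close d n \<pi>)"
      using sum_deg_le[of d n \<pi>] by (subst sum_pq_close_pos_swap) auto
  qed
  also have "\<dots> = 2 * real d * real n * fact n + ?X"
    by (simp add: sum.distrib card_perms)
  finally have "(real n - 1) * ?X \<le> 2 * real d * real n * fact n"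
    by (simp add: algebra_simps)
  also have "\<dots> \<le> 2 * real d * (2 * (real n - 1)) * fact n"
    using assms by (intro mult_left_mono mult_right_mono) auto
  also have "\<dots> = (real n - 1) * (4 * real d * fact n)" by simp
  finally show ?thesis using assms by simp
qed

text \<open>The same argument with the weight \<open>?N\<close>, which grows by at most 4 under a
  swap. The square reappears once on the right and is absorbed; the linear term is controlled by the
  first moment.\<close>

lemma sum_num_close_sq_le:
  assumes "n \<ge> 2"
  shows "(\<Sum>\<pi>\<in>perms n. (real (num_close d n \<pi>))\<^sup>2) \<le> 16 * real d * (real d + 2) * fact n"
proof -
  let ?N = "\<lambda>\<pi>. real (num_close d n \<pi>)"
  let ?X = "\<Sum>\<pi>\<in>perms n. ?N \<pi>" and ?Y = "\<Sum>\<pi>\<in>perms n. (?N \<pi>)\<^sup>2"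
  have "real n * ?Y = (\<Sum>\<pi>\<in>perms n. \<Sum>p\<in>{1..<n}. \<Sum>q\<in>{1..n}.
            of_bool (p \<in> close_pos d n (swap \<pi> p q)) * ?N (swap \<pi> p q))"
    using sum_perms_exchange[where h = ?N and d = d and n = n]
    by (simp add: sum_distrib_left power2_eq_square mult.assoc del: sum_of_bool_eq sum_of_bool_mult_eq)
  also have "\<dots> \<le> (\<Sum>\<pi>\<in>perms n. \<Sum>p\<in>{1..<n}. \<Sum>q\<in>{1..n}.
            of_bool (p \<in> close_pos d n (swap \<pi> p q)) * (?N \<pi> + 4))"
  proof (intro sum_mono mult_left_mono)
    fix \<pi> p q
    show "?N (swap \<pi> p q) \<le> ?N \<pi> + 4"
      using num_close_swap_le[of d n \<pi> p q] by linarith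
  qed auto
  also have "\<dots> = (\<Sum>\<pi>\<in>perms n. (\<Sum>p\<in>{1..<n}. \<Sum>q\<in>{1..n}.
            of_bool (p \<in> close_pos d n (swap \<pi> p q))) * (?N \<pi> + 4))"
    by (simp only: sum_distrib_right)
  also have "\<dots> \<le> (\<Sum>\<pi>\<in>perms n. (2 * real d * real n + ?N \<pi>) * (?N \<pi> + 4))"
  proof (intro sum_mono mult_right_mono)
    fix \<pi> assume "\<pi> \<in> perms n"
    then show "(\<Sum>p\<in>{1..<n}. \<Sum>q\<in>{1..n}. of_bool (p \<in> close_pos d n (swap \<pi> p q)))
        \<le> 2 * real d * real n + ?N \<pi>"
      using sum_deg_le[of d n \<pi>] by (subst sum_pq_close_pos_swap) auto
  qed auto
  also have "\<dots> = (\<Sum>\<pi>\<in>perms n. 8 * real d * real n + (2 * real d * real n + 4) * ?N \<pi> + (?N \<pi>)\<^sup>2)"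
    by (intro sum.cong refl) (simp add: power2_eq_square algebra_simps)
  also have "\<dots> = 8 * real d * real n * fact n + (2 * real d * real n + 4) * ?X + ?Y"
    by (simp add: sum.distrib card_perms sum_distrib_left)
  also have "\<dots> \<le> 8 * real d * real n * fact n + (2 * real d * real n + 4) * (4 * real d * fact n) + ?Y"
    using sum_num_close_le[OF assms, of d] by (intro add_mono mult_left_mono) auto
  finally have "(real n - 1) * ?Y \<le> 8 * real d * fact n * (real n * (1 + real d) + 2)"
    by (simp add: algebra_simps)
  also have "\<dots> \<le> 8 * real d * fact n * (2 * (real n - 1) * (1 + real d) + 2 * (real n - 1))"
    using assms by (intro mult_left_mono add_mono mult_right_mono) auto
  also have "\<dots> = (real n - 1) * (16 * real d * (real d + 2) * fact n)"
    by (simp add: algebra_simps)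
  finally show ?thesis using assms by simp
qed

section \<open>Consecutive close positions\<close>

definition consec_close :: "nat \<Rightarrow> nat \<Rightarrow> (nat \<Rightarrow> nat) \<Rightarrow> nat \<Rightarrow> bool" where
  "consec_close d n \<pi> p \<longleftrightarrow> p \<in> close_pos d n \<pi> \<and> p - 1 \<in> close_pos d n \<pi>"

text \<open>Excluding 0 from \<open>A\<close> makes the truncated predecessor injective.\<close>

lemma sum_pred_close_pos_le:
  assumes "finite A" "A \<subseteq> {1..}"
  shows "(\<Sum>p\<in>A. of_bool (p - 1 \<in> close_pos d n \<pi>)) \<le> real (num_close d n \<pi>)"
proof -
  have "inj_on (\<lambda>p. p - 1) A"
  proof (rule inj_onI)
    fix x y assume "x \<in> A" "y \<in> A" "x - 1 = y - 1"
    moreover from this assms have "1 \<le> x" "1 \<le> y" by auto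
    ultimately show "x = y" by linarith
  qed
  then have "card (A \<inter> {p. p - 1 \<in> close_pos d n \<pi>}) \<le> num_close d n \<pi>"
    unfolding num_close_def
    by (intro card_inj_on_le[where f = "\<lambda>p. p - 1"]) (auto intro: inj_on_subset)
  then show ?thesis using assms(1) by simp
qed

lemma sum_close_pos_le:
  assumes "finite A"
  shows "(\<Sum>p\<in>A. of_bool (p \<in> close_pos d n \<pi>)) \<le> real (num_close d n \<pi>)"
proof -
  have "card (A \<inter> {p. p \<in> close_pos d n \<pi>}) \<le> num_close d n \<pi>"
    unfolding num_close_def by (intro card_mono) auto
  then show ?thesis using assms(1) by simp
qed

text \<open>Unless \<open>q\<close> is \<open>p - 1\<close> or \<open>p\<close>, position
  \<open>p - 1\<close> is untouched by the swap, and the entry \<open>\<pi> q\<close> brought to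
  \<open>Suc p\<close> must be close to \<open>\<pi> p\<close>. The two exceptional values of
  \<open>q\<close> follow from symmetry of closeness.\<close>

lemma consec_close_swap:
  assumes "consec_close d n (swap \<pi> (Suc p) q) p"
  shows "(p - 1 \<in> close_pos d n \<pi> \<and> (q = p - 1 \<or> close d (\<pi> q) (\<pi> p))) \<or> (q = p \<and> p \<in> close_pos d n \<pi>)"
  using assms
  by (auto simp: consec_close_def close_pos_def Transposition.transpose_def close_sym split: if_splits)

text \<open>The third entry of a consecutive pair is resampled by swapping \<open>Suc p\<close> with
  each \<open>q\<close>. Given that \<open>p - 1\<close> is close, at most \<open>2 * d + 1\<close>
  choices of \<open>q\<close> make \<open>p\<close> close as well; \<open>q = p\<close> adds one
  case. So consecutive pairs are rarer than close positions by a factor of order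
  \<open>1 / n\<close>.\<close>

lemma sum_consec_close_le:
  "real n * (\<Sum>\<pi>\<in>perms n. \<Sum>p\<in>{1..<n}. of_bool (consec_close d n \<pi> p))
     \<le> (2 * real d + 2) * (\<Sum>\<pi>\<in>perms n. real (num_close d n \<pi>))"
proof -
  have *: "(\<Sum>\<pi>\<in>perms n. of_bool (consec_close d n (swap \<pi> (Suc p) q) p))
      = (\<Sum>\<pi>\<in>perms n. of_bool (consec_close d n \<pi> p) :: real)"
    if "p \<in> {1..<n}" "q \<in> {1..n}" for p q
    using that
    by (intro sum_permutations_compose_right[symmetric] permutes_swap_id) auto
  have "real n * (\<Sum>\<pi>\<in>perms n. \<Sum>p\<in>{1..<n}. of_bool (consec_close d n \<pi> p))
      = (\<Sum>p\<in>{1..<n}. \<Sum>q\<in>{1..n}. \<Sum>\<pi>\<in>perms n. of_bool (consec_close d n \<pi> p))"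
    by (subst sum.swap) (simp add: sum_distrib_left del: sum_of_bool_eq)
  also have "\<dots> = (\<Sum>p\<in>{1..<n}. \<Sum>q\<in>{1..n}. \<Sum>\<pi>\<in>perms n. of_bool (consec_close d n (swap \<pi> (Suc p) q) p))"
    by (intro sum.cong refl *[symmetric])
  also have "\<dots> = (\<Sum>\<pi>\<in>perms n. \<Sum>p\<in>{1..<n}. \<Sum>q\<in>{1..n}. of_bool (consec_close d n (swap \<pi> (Suc p) q) p))"
    by (rule sym, subst sum.swap, rule sum.cong[OF refl], rule sum.swap)
  also have "\<dots> \<le> (\<Sum>\<pi>\<in>perms n. (2 * real d + 2) * real (num_close d n \<pi>))"
  proof (rule sum_mono)
    fix \<pi> assume "\<pi> \<in> perms n"
    then have \<pi>: "\<pi> permutes {1..n}" by simp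
    have "(\<Sum>q\<in>{1..n}. of_bool (consec_close d n (swap \<pi> (Suc p) q) p))
        \<le> (2 * real d + 1) * of_bool (p - 1 \<in> close_pos d n \<pi>) + of_bool (p \<in> close_pos d n \<pi>)"
      (is "?L \<le> _") if "p \<in> {1..<n}" for p
    proof -
      have "?L \<le> (\<Sum>q\<in>{1..n}. (if q = p - 1 then of_bool (p - 1 \<in> close_pos d n \<pi>) else 0)
          + of_bool (close d (\<pi> q) (\<pi> p)) * of_bool (p - 1 \<in> close_pos d n \<pi>)
          + (if q = p then of_bool (p \<in> close_pos d n \<pi>) else 0))"
      proof (rule sum_mono)
        fix q
        show "of_bool (consec_close d n (swap \<pi> (Suc p) q) p)
          \<le> (if q = p - 1 then of_bool (p - 1 \<in> close_pos d n \<pi>) else 0)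
          + of_bool (close d (\<pi> q) (\<pi> p)) * of_bool (p - 1 \<in> close_pos d n \<pi>)
          + (if q = p then of_bool (p \<in> close_pos d n \<pi>) else 0 :: real)"
          using consec_close_swap[of d n \<pi> p q] by auto
      qed
      also have "\<dots> \<le> of_bool (p - 1 \<in> close_pos d n \<pi>)
          + real (close_deg d n (\<pi> p)) * of_bool (p - 1 \<in> close_pos d n \<pi>)
          + of_bool (p \<in> close_pos d n \<pi>)"
        unfolding sum.distrib sum_distrib_right[symmetric] sum_perm_close[OF \<pi>] by simp
      also have "\<dots> \<le> of_bool (p - 1 \<in> close_pos d n \<pi>)
          + 2 * real d * of_bool (p - 1 \<in> close_pos d n \<pi>) + of_bool (p \<in> close_pos d n \<pi>)"
        using close_deg_le[of d n "\<pi> p"] by (intro add_mono mult_right_mono) auto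
      finally show ?thesis by (simp add: algebra_simps)
    qed
    then have "(\<Sum>p\<in>{1..<n}. \<Sum>q\<in>{1..n}. of_bool (consec_close d n (swap \<pi> (Suc p) q) p))
        \<le> (\<Sum>p\<in>{1..<n}. (2 * real d + 1) * of_bool (p - 1 \<in> close_pos d n \<pi>)
             + of_bool (p \<in> close_pos d n \<pi>))"
      by (rule sum_mono)
    also have "\<dots> = (2 * real d + 1) * (\<Sum>p\<in>{1..<n}. of_bool (p - 1 \<in> close_pos d n \<pi>))
             + real (num_close d n \<pi>)"
      unfolding sum.distrib sum_distrib_left[symmetric] sum_close_pos ..
    also have "\<dots> \<le> (2 * real d + 1) * real (num_close d n \<pi>) + real (num_close d n \<pi>)"
      by (intro add_mono mult_left_mono sum_pred_close_pos_le) auto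
    finally show "(\<Sum>p\<in>{1..<n}. \<Sum>q\<in>{1..n}. of_bool (consec_close d n (swap \<pi> (Suc p) q) p))
        \<le> (2 * real d + 2) * real (num_close d n \<pi>)"
      by (simp add: algebra_simps)
  qed
  finally show ?thesis by (simp only: sum_distrib_left)
qed

subsection \<open>Poisson limit of the number of close positions\<close>

text \<open>A union bound over the ways in which the hypotheses of \<open>num_close_swap_eq\<close>
  can fail. The first two summands detect a nearby close position of \<open>\<pi>\<close>. The last
  group involves the swapped permutation alone, so the bijection can later be applied to it.\<close>

lemma not_num_close_swap_eq_le:
  "of_bool (p \<in> close_pos d n (swap \<pi> p q) \<and> num_close d n (swap \<pi> p q) \<noteq> num_close d n \<pi> + 1)
   \<le> (of_bool (p \<in> close_pos d n \<pi>) + of_bool (p - 1 \<in> close_pos d n \<pi>))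
       * of_bool (p \<in> close_pos d n (swap \<pi> p q))
   + (of_bool (q \<in> close_pos d n \<pi>) + of_bool (q - 1 \<in> close_pos d n \<pi>))
       * of_bool (p \<in> close_pos d n (swap \<pi> p q))
   + (of_bool (consec_close d n (swap \<pi> p q) p)
      + of_bool (p \<in> close_pos d n (swap \<pi> p q))
        * (of_bool (q \<in> close_pos d n (swap \<pi> p q)) + of_bool (q - 1 \<in> close_pos d n (swap \<pi> p q)))
      :: real)"
proof (cases "{p - 1, p, q - 1, q} \<inter> close_pos d n \<pi> = {} \<and>
    {p - 1, q - 1, q} \<inter> close_pos d n (swap \<pi> p q) \<subseteq> {p}")
  case True
  then show ?thesis using num_close_swap_eq[of p d n \<pi> q] by (auto simp del: o_apply)
next
  case False
  then show ?thesis by (auto simp: consec_close_def of_bool_def simp del: o_apply)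
qed

text \<open>At most \<open>2 * N\<close> positions are close or follow a close one, where
  \<open>N\<close> is \<open>num_close d n \<pi>\<close>. Fixing such a \<open>p\<close> leaves at
  most \<open>2 * d + 1\<close> indices \<open>q\<close>, and fixing such a \<open>q\<close> at most
  \<open>2 * d + 1\<close> positions \<open>p\<close>.\<close>

lemma mixed_sum_le:
  assumes "\<pi> permutes {1..n}"
  shows "(\<Sum>p\<in>{1..<n}. \<Sum>q\<in>{1..n}.
       (of_bool (p \<in> close_pos d n \<pi>) + of_bool (p - 1 \<in> close_pos d n \<pi>))
       * of_bool (p \<in> close_pos d n (swap \<pi> p q))
     + (of_bool (q \<in> close_pos d n \<pi>) + of_bool (q - 1 \<in> close_pos d n \<pi>))
       * of_bool (p \<in> close_pos d n (swap \<pi> p q)))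
   \<le> 4 * (2 * real d + 1) * real (num_close d n \<pi>)" (is "?L \<le> _")
proof -
  define H where "H = close_pos d n \<pi>"
  define e where "e = (\<lambda>p. of_bool (p \<in> H) + of_bool (p - 1 \<in> H) :: real)"
  define u where "u = (\<lambda>p q. of_bool (p \<in> close_pos d n (swap \<pi> p q)) :: real)"
  have e0: "e p \<ge> 0" for p by (simp add: e_def)
  have e_sum: "sum e A \<le> 2 * real (num_close d n \<pi>)" if "finite A" "A \<subseteq> {1..}" for A
    using sum_close_pos_le[OF that(1), of d n \<pi>] sum_pred_close_pos_le[OF that, of d n \<pi>]
    unfolding e_def sum.distrib H_def by linarith
  have uq: "(\<Sum>q\<in>{1..n}. u p q) \<le> 2 * real d + 1" if "p \<in> {1..<n}" for p
  proof -
    have "of_bool (p \<in> close_pos d n \<pi>) \<le> (1::real)" by simp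
    then show ?thesis
      using close_deg_le[of d n "\<pi> (Suc p)"] unfolding u_def sum_q_close_pos_swap[OF assms that]
      by linarith
  qed
  have up: "(\<Sum>p\<in>{1..<n}. u p q) \<le> 2 * real d + 1" for q
    unfolding u_def by (rule sum_p_close_pos_swap_le[OF assms])
  have "?L = (\<Sum>p\<in>{1..<n}. \<Sum>q\<in>{1..n}. e p * u p q + e q * u p q)"
    by (simp only: e_def u_def H_def)
  also have "\<dots> = (\<Sum>p\<in>{1..<n}. e p * (\<Sum>q\<in>{1..n}. u p q)) + (\<Sum>p\<in>{1..<n}. \<Sum>q\<in>{1..n}. e q * u p q)"
    by (simp only: sum.distrib sum_distrib_left)
  also have "(\<Sum>p\<in>{1..<n}. \<Sum>q\<in>{1..n}. e q * u p q) = (\<Sum>q\<in>{1..n}. e q * (\<Sum>p\<in>{1..<n}. u p q))"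
    by (subst sum.swap) (simp only: sum_distrib_left)
  also have "(\<Sum>p\<in>{1..<n}. e p * (\<Sum>q\<in>{1..n}. u p q)) \<le> (\<Sum>p\<in>{1..<n}. e p * (2 * real d + 1))"
    by (intro sum_mono mult_left_mono uq e0)
  also have "(\<Sum>q\<in>{1..n}. e q * (\<Sum>p\<in>{1..<n}. u p q)) \<le> (\<Sum>q\<in>{1..n}. e q * (2 * real d + 1))"
    by (intro sum_mono mult_left_mono up e0)
  also have "(\<Sum>p\<in>{1..<n}. e p * (2 * real d + 1)) + (\<Sum>q\<in>{1..n}. e q * (2 * real d + 1))
      = (sum e {1..<n} + sum e {1..n}) * (2 * real d + 1)"
    by (simp only: sum_distrib_right distrib_right)
  also have "\<dots> \<le> (2 * real (num_close d n \<pi>) + 2 * real (num_close d n \<pi>)) * (2 * real d + 1)"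
    by (intro mult_right_mono add_mono e_sum) auto
  also have "\<dots> = 4 * (2 * real d + 1) * real (num_close d n \<pi>)"
    by (simp add: algebra_simps)
  finally show ?thesis by this simp_all
qed

text \<open>The first summand is constant in \<open>q\<close>, whence the factor \<open>n\<close>.
  The second is a product of a function of \<open>p\<close> and a function of \<open>q\<close>, so
  its double sum factors.\<close>

lemma pure_sum_le:
  "(\<Sum>p\<in>{1..<n}. \<Sum>q\<in>{1..n}. of_bool (consec_close d n \<pi> p)
      + of_bool (p \<in> close_pos d n \<pi>) * (of_bool (q \<in> close_pos d n \<pi>) + of_bool (q - 1 \<in> close_pos d n \<pi>)))
   \<le> real n * (\<Sum>p\<in>{1..<n}. of_bool (consec_close d n \<pi> p)) + 2 * (real (num_close d n \<pi>))\<^sup>2"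
  (is "?L \<le> _")
proof -
  let ?N = "real (num_close d n \<pi>)"
  define e where "e = (\<Sum>q\<in>{1..n}. of_bool (q \<in> close_pos d n \<pi>) + of_bool (q - 1 \<in> close_pos d n \<pi>) :: real)"
  have e: "e \<le> 2 * ?N"
    using sum_close_pos_le[of "{1..n}" d n \<pi>] sum_pred_close_pos_le[of "{1..n}" d n \<pi>]
    unfolding e_def sum.distrib by fastforce
  have "?L = (\<Sum>p\<in>{1..<n}. real n * of_bool (consec_close d n \<pi> p) + of_bool (p \<in> close_pos d n \<pi>) * e)"
    unfolding sum.distrib[of _ _ "{1..n}"] sum_distrib_left[symmetric] e_def by simp
  also have "\<dots> = real n * (\<Sum>p\<in>{1..<n}. of_bool (consec_close d n \<pi> p)) + ?N * e"
    unfolding sum.distrib sum_distrib_left[symmetric] sum_distrib_right[symmetric] sum_close_pos ..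
  also have "?N * e \<le> ?N * (2 * ?N)"
    by (intro mult_left_mono e) auto
  finally show ?thesis by (simp add: power2_eq_square)
qed

text \<open>An approximate Stein identity for mean \<open>2 * d\<close>. In the constant, the first
  summand comes from the degree deficit, \<open>4 * d * (10 * d + 7)\<close> collects all multiples
  of the first moment bound, and the last is twice the second moment bound.\<close>

lemma stein_error_bound:
  fixes f :: "nat \<Rightarrow> real"
  assumes f: "\<And>w. 0 \<le> f w" "\<And>w. f w \<le> 1" and n: "n \<ge> 2"
  shows "real n * \<bar>\<Sum>\<pi>\<in>perms n. real (num_close d n \<pi>) * f (num_close d n \<pi>)
            - 2 * real d * f (num_close d n \<pi> + 1)\<bar>
    \<le> (2 * real d * (2 * real d + 1) + 4 * real d * (10 * real d + 7) + 32 * real d * (real d + 2)) * fact n"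
proof -
  define N where "N = num_close d n"
  define P where "P = perms n"
  define u where "u = (\<lambda>\<pi> p q. of_bool (p \<in> close_pos d n (swap \<pi> p q)) :: real)"
  define bad where "bad = (\<lambda>\<pi> p q. of_bool (p \<in> close_pos d n (swap \<pi> p q)
      \<and> N (swap \<pi> p q) \<noteq> N \<pi> + 1) :: real)"
  define D where "D = (\<lambda>\<pi>. \<Sum>p\<in>{1..<n}. real (close_deg d n (\<pi> (Suc p))))"
  define c where "c = 2 * real d * (2 * real d + 1)"
  let ?S = "\<lambda>g. \<Sum>\<pi>\<in>P. \<Sum>p\<in>{1..<n}. \<Sum>q\<in>{1..n}. g \<pi> p q :: real"
  have P: "\<pi> permutes {1..n}" if "\<pi> \<in> P" for \<pi> using that by (simp add: P_def)
  have X: "(\<Sum>\<pi>\<in>P. real (N \<pi>)) \<le> 4 * real d * fact n"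
    using sum_num_close_le[OF n, of d] by (simp add: P_def N_def)
  have Y: "(\<Sum>\<pi>\<in>P. (real (N \<pi>))\<^sup>2) \<le> 16 * real d * (real d + 2) * fact n"
    using sum_num_close_sq_le[OF n, of d] by (simp add: P_def N_def)
  have "real n * (\<Sum>\<pi>\<in>P. \<Sum>p\<in>{1..<n}. of_bool (consec_close d n \<pi> p))
      \<le> (2 * real d + 2) * (\<Sum>\<pi>\<in>P. real (N \<pi>))"
    unfolding P_def N_def by (rule sum_consec_close_le)
  also have "\<dots> \<le> (2 * real d + 2) * (4 * real d * fact n)"
    by (intro mult_left_mono X) auto
  finally have Z: "real n * (\<Sum>\<pi>\<in>P. \<Sum>p\<in>{1..<n}. of_bool (consec_close d n \<pi> p))
      \<le> (2 * real d + 2) * (4 * real d * fact n)" .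

  have "?S bad \<le> ?S (\<lambda>\<pi> p q.
     ((of_bool (p \<in> close_pos d n \<pi>) + of_bool (p - 1 \<in> close_pos d n \<pi>))
       * of_bool (p \<in> close_pos d n (swap \<pi> p q))
   + (of_bool (q \<in> close_pos d n \<pi>) + of_bool (q - 1 \<in> close_pos d n \<pi>))
       * of_bool (p \<in> close_pos d n (swap \<pi> p q)))
   + (of_bool (consec_close d n (swap \<pi> p q) p)
      + of_bool (p \<in> close_pos d n (swap \<pi> p q))
        * (of_bool (q \<in> close_pos d n (swap \<pi> p q)) + of_bool (q - 1 \<in> close_pos d n (swap \<pi> p q)))))"
    unfolding bad_def N_def by (intro sum_mono not_num_close_swap_eq_le)
  also have "\<dots> = ?S (\<lambda>\<pi> p q.
     (of_bool (p \<in> close_pos d n \<pi>) + of_bool (p - 1 \<in> close_pos d n \<pi>))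
       * of_bool (p \<in> close_pos d n (swap \<pi> p q))
   + (of_bool (q \<in> close_pos d n \<pi>) + of_bool (q - 1 \<in> close_pos d n \<pi>))
       * of_bool (p \<in> close_pos d n (swap \<pi> p q)))
   + ?S (\<lambda>\<pi> p q. of_bool (consec_close d n (swap \<pi> p q) p)
      + of_bool (p \<in> close_pos d n (swap \<pi> p q))
        * (of_bool (q \<in> close_pos d n (swap \<pi> p q)) + of_bool (q - 1 \<in> close_pos d n (swap \<pi> p q))))"
    (is "_ = ?A + ?B")
    by (simp only: sum.distrib)
  also have "?A \<le> (\<Sum>\<pi>\<in>P. 4 * (2 * real d + 1) * real (N \<pi>))"
    unfolding N_def by (intro sum_mono mixed_sum_le P)
  also have "\<dots> = 4 * (2 * real d + 1) * (\<Sum>\<pi>\<in>P. real (N \<pi>))"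
    by (simp only: sum_distrib_left)
  also have "\<dots> \<le> 4 * (2 * real d + 1) * (4 * real d * fact n)"
    by (intro mult_left_mono X) auto
  \<comment> \<open>All occurrences of the permutation in \<open>?B\<close> are swapped, so the
    bijection replaces them by \<open>\<pi>\<close> itself.\<close>
  also have "?B = ?S (\<lambda>\<pi> p q. of_bool (consec_close d n \<pi> p)
      + of_bool (p \<in> close_pos d n \<pi>)
        * (of_bool (q \<in> close_pos d n \<pi>) + of_bool (q - 1 \<in> close_pos d n \<pi>)))"
    unfolding P_def by (rule sum_perms_swap)
  also have "\<dots> \<le> (\<Sum>\<pi>\<in>P. real n * (\<Sum>p\<in>{1..<n}. of_bool (consec_close d n \<pi> p)) + 2 * (real (N \<pi>))\<^sup>2)"
    unfolding N_def by (intro sum_mono pure_sum_le)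
  also have "\<dots> = real n * (\<Sum>\<pi>\<in>P. \<Sum>p\<in>{1..<n}. of_bool (consec_close d n \<pi> p)) + 2 * (\<Sum>\<pi>\<in>P. (real (N \<pi>))\<^sup>2)"
    by (simp only: sum.distrib sum_distrib_left)
  also have "\<dots> \<le> (2 * real d + 2) * (4 * real d * fact n) + 2 * (16 * real d * (real d + 2) * fact n)"
    by (intro add_mono Z mult_left_mono Y) auto
  finally have bad: "?S bad \<le> 4 * (2 * real d + 1) * (4 * real d * fact n)
      + ((2 * real d + 2) * (4 * real d * fact n) + 2 * (16 * real d * (real d + 2) * fact n))"
    by simp

  have "(\<Sum>\<pi>\<in>P. real n * real (N \<pi>) * f (N \<pi>)) = ?S (\<lambda>\<pi> p q. u \<pi> p q * f (N (swap \<pi> p q)))"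
    unfolding P_def N_def u_def by (rule sum_perms_exchange)
  moreover have "(\<Sum>\<pi>\<in>P. (D \<pi> + real (N \<pi>)) * f (N \<pi> + 1)) = ?S (\<lambda>\<pi> p q. u \<pi> p q * f (N \<pi> + 1))"
  proof (intro sum.cong refl)
    fix \<pi> assume "\<pi> \<in> P"
    then have "D \<pi> + real (N \<pi>) = (\<Sum>p\<in>{1..<n}. \<Sum>q\<in>{1..n}. u \<pi> p q)"
      using sum_pq_close_pos_swap[OF P, of \<pi> d] by (simp only: D_def N_def u_def)
    then show "(D \<pi> + real (N \<pi>)) * f (N \<pi> + 1) = (\<Sum>p\<in>{1..<n}. \<Sum>q\<in>{1..n}. u \<pi> p q * f (N \<pi> + 1))"
      by (simp only: sum_distrib_right)
  qed
  ultimately have "\<bar>(\<Sum>\<pi>\<in>P. real n * real (N \<pi>) * f (N \<pi>)) - (\<Sum>\<pi>\<in>P. (D \<pi> + real (N \<pi>)) * f (N \<pi> + 1))\<bar>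
      = \<bar>?S (\<lambda>\<pi> p q. u \<pi> p q * (f (N (swap \<pi> p q)) - f (N \<pi> + 1)))\<bar>"
    by (simp only: sum_subtractf right_diff_distrib)
  also have "\<dots> \<le> ?S (\<lambda>\<pi> p q. \<bar>u \<pi> p q * (f (N (swap \<pi> p q)) - f (N \<pi> + 1))\<bar>)"
    by (intro order.trans[OF sum_abs] sum_mono order.refl)
  \<comment> \<open>Values of \<open>f\<close> lie in the unit interval, so a triple costs at most
    1, and only if the swap does not raise \<open>N\<close> by exactly 1.\<close>
  also have "\<dots> \<le> ?S bad"
  proof (intro sum_mono)
    fix \<pi> p q
    have "\<bar>f (N (swap \<pi> p q)) - f (N \<pi> + 1)\<bar> \<le> 1"
      using f[of "N (swap \<pi> p q)"] f[of "N \<pi> + 1"] by linarith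
    then show "\<bar>u \<pi> p q * (f (N (swap \<pi> p q)) - f (N \<pi> + 1))\<bar> \<le> bad \<pi> p q"
      by (auto simp: u_def bad_def simp del: o_apply)
  qed
  finally have 1: "\<bar>(\<Sum>\<pi>\<in>P. real n * real (N \<pi>) * f (N \<pi>)) - (\<Sum>\<pi>\<in>P. (D \<pi> + real (N \<pi>)) * f (N \<pi> + 1))\<bar>
      \<le> ?S bad" .

  \<comment> \<open>It remains to replace the number \<open>D \<pi> + N \<pi>\<close> of admissible
    pairs by \<open>2 * d * n\<close>, at the cost \<open>c + N \<pi>\<close>.\<close>
  have "\<bar>(\<Sum>\<pi>\<in>P. (D \<pi> + real (N \<pi>)) * f (N \<pi> + 1)) - (\<Sum>\<pi>\<in>P. 2 * real d * real n * f (N \<pi> + 1))\<bar>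
      = \<bar>\<Sum>\<pi>\<in>P. (D \<pi> + real (N \<pi>) - 2 * real d * real n) * f (N \<pi> + 1)\<bar>"
    by (simp only: sum_subtractf left_diff_distrib)
  also have "\<dots> \<le> (\<Sum>\<pi>\<in>P. \<bar>(D \<pi> + real (N \<pi>) - 2 * real d * real n) * f (N \<pi> + 1)\<bar>)"
    by (rule sum_abs)
  also have "\<dots> \<le> (\<Sum>\<pi>\<in>P. c + real (N \<pi>))"
  proof (rule sum_mono)
    fix \<pi> assume "\<pi> \<in> P"
    have "2 * real d * real n - c \<le> D \<pi>"
      unfolding D_def c_def by (rule sum_deg_ge_2d[OF P[OF \<open>\<pi> \<in> P\<close>]])
    moreover have "D \<pi> \<le> 2 * real d * real n"
      unfolding D_def by (rule sum_deg_le)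
    moreover have "0 \<le> c" by (simp add: c_def)
    ultimately have "\<bar>D \<pi> + real (N \<pi>) - 2 * real d * real n\<bar> \<le> c + real (N \<pi>)"
      by linarith
    then have "\<bar>D \<pi> + real (N \<pi>) - 2 * real d * real n\<bar> * f (N \<pi> + 1) \<le> (c + real (N \<pi>)) * 1"
      using f \<open>0 \<le> c\<close> by (intro mult_mono) auto
    then show "\<bar>(D \<pi> + real (N \<pi>) - 2 * real d * real n) * f (N \<pi> + 1)\<bar> \<le> c + real (N \<pi>)"
      using f by (simp add: abs_mult)
  qed
  also have "\<dots> = c * fact n + (\<Sum>\<pi>\<in>P. real (N \<pi>))"
    by (simp add: sum.distrib P_def card_perms)
  finally have 2: "\<bar>(\<Sum>\<pi>\<in>P. (D \<pi> + real (N \<pi>)) * f (N \<pi> + 1)) - (\<Sum>\<pi>\<in>P. 2 * real d * real n * f (N \<pi> + 1))\<bar>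
      \<le> c * fact n + 4 * real d * fact n" using X by linarith

  have "real n * \<bar>\<Sum>\<pi>\<in>P. real (N \<pi>) * f (N \<pi>) - 2 * real d * f (N \<pi> + 1)\<bar>
      = \<bar>real n * (\<Sum>\<pi>\<in>P. real (N \<pi>) * f (N \<pi>) - 2 * real d * f (N \<pi> + 1))\<bar>"
    by (simp add: abs_mult)
  also have "real n * (\<Sum>\<pi>\<in>P. real (N \<pi>) * f (N \<pi>) - 2 * real d * f (N \<pi> + 1))
      = (\<Sum>\<pi>\<in>P. real n * real (N \<pi>) * f (N \<pi>)) - (\<Sum>\<pi>\<in>P. 2 * real d * real n * f (N \<pi> + 1))"
    by (simp add: sum_subtractf right_diff_distrib sum_distrib_left mult_ac)
  finally have "real n * \<bar>\<Sum>\<pi>\<in>P. real (N \<pi>) * f (N \<pi>) - 2 * real d * f (N \<pi> + 1)\<bar>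
      \<le> ?S bad + (c * fact n + 4 * real d * fact n)"
    using 1 2 by linarith
  also have "\<dots> \<le> (4 * (2 * real d + 1) * (4 * real d * fact n)
      + ((2 * real d + 2) * (4 * real d * fact n) + 2 * (16 * real d * (real d + 2) * fact n)))
      + (c * fact n + 4 * real d * fact n)"
    using bad by linarith
  also have "\<dots> = (2 * real d * (2 * real d + 1) + 4 * real d * (10 * real d + 7) + 32 * real d * (real d + 2)) * fact n"
    unfolding c_def by (simp add: algebra_simps)
  finally show ?thesis unfolding P_def N_def .
qed

text \<open>
  A bounded solution of Stein's equation for the Poisson law with mean \<open>l\<close> and the test set \<open>{0}\<close>:
  \<open>f (w + 1) = exp (- l) * (\<Sum>j. l ^ j * w! / (w + 1 + j)!)\<close>.
\<close>
lemma stein_solution: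
  fixes l :: real
  assumes "l > 0"
  obtains f :: "nat \<Rightarrow> real" where "\<And>w. 0 \<le> f w" "\<And>w. f w \<le> 1"
    "\<And>w. real w * f w - l * f (w + 1) = exp (- l) - of_bool (w = 0)"
proof -
  define t where "t = (\<lambda>w j. l ^ j * fact w / fact (w + 1 + j))"
  \<comment> \<open>Since \<open>w! * j!\<close> divides \<open>(w + j)!\<close>, the series is
    dominated by the exponential series. This gives both summability and the bound 1 on
    \<open>f\<close>.\<close>
  have t_le: "t w j \<le> l ^ j / fact j" for w j
  proof -
    have "fact w * fact j \<le> (fact (w + 1 + j) :: nat)"
      by (rule order.trans[OF dvd_imp_le[OF fact_fact_dvd_fact]]) (auto intro: fact_mono)
    then have "fact w * fact j \<le> (fact (w + 1 + j) :: real)"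
      by (metis of_nat_fact of_nat_le_iff of_nat_mult)
    then show ?thesis using assms by (simp add: t_def field_simps mult_left_mono del: fact_Suc)
  qed
  have t0: "0 \<le> t w j" for w j using assms by (simp add: t_def)
  have exp_sums: "(\<lambda>j. l ^ j / fact j) sums exp l"
    using exp_converges[of l] by (simp add: field_simps)
  have t_summable: "summable (t w)" for w
    using t_le t0 by (intro summable_comparison_test'[OF sums_summable[OF exp_sums], of 0]) auto
  have t_suminf_le: "suminf (t w) \<le> exp l" for w
    using suminf_le[OF t_le t_summable sums_summable[OF exp_sums]] sums_unique[OF exp_sums] by simp
  \<comment> \<open>Splitting off the term \<open>j = 0\<close> and shifting the index gives the
    recursion that becomes Stein's equation at positive arguments.\<close>
  have t_step: "real (Suc w) * suminf (t w) = 1 + l * suminf (t (Suc w))" for w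
  proof -
    have "real (Suc w) * t w (Suc j) = l * t (Suc w) j" for j
      by (simp add: t_def field_simps del: fact_Suc) (simp add: algebra_simps)
    moreover have "real (Suc w) * t w 0 = 1" by (simp add: t_def)
    moreover have "suminf (t w) = t w 0 + (\<Sum>j. t w (Suc j))"
      using suminf_split_head[OF t_summable[of w]] by simp
    moreover have "real (Suc w) * (\<Sum>j. t w (Suc j)) = (\<Sum>j. real (Suc w) * t w (Suc j))"
      using t_summable[of w] by (subst suminf_mult) (auto simp: summable_Suc_iff)
    moreover have "l * suminf (t (Suc w)) = (\<Sum>j. l * t (Suc w) j)"
      by (subst suminf_mult[OF t_summable]) simp
    ultimately show ?thesis by (simp add: algebra_simps)
  qed
  have t_first: "l * suminf (t 0) = exp l - 1"
  proof -
    have "(\<lambda>j. l ^ Suc j / fact (Suc j)) sums (exp l - 1)"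
      using exp_sums by (subst sums_Suc_iff) simp
    moreover have "l ^ Suc j / fact (Suc j) = l * t 0 j" for j by (simp add: t_def)
    ultimately have "(\<lambda>j. l * t 0 j) sums (exp l - 1)" by simp
    then show ?thesis using sums_unique suminf_mult[OF t_summable] by metis
  qed
  \<comment> \<open>The value 0 at 0 respects both bounds, and the equation at \<open>w = 0\<close>
    then amounts to \<open>t_first\<close>.\<close>
  define f where "f = (\<lambda>w. case w of 0 \<Rightarrow> 0 | Suc v \<Rightarrow> exp (- l) * suminf (t v))"
  show ?thesis
  proof
    show "0 \<le> f w" for w
      using suminf_nonneg[OF t_summable t0] by (auto simp: f_def split: nat.split)
    show "f w \<le> 1" for w
      using t_suminf_le by (auto simp: f_def exp_minus field_simps split: nat.split)
    show "real w * f w - l * f (w + 1) = exp (- l) - of_bool (w = 0)" for w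
    proof (cases w)
      case 0
      have "exp (- l) * (l * suminf (t 0)) = 1 - exp (- l)"
        unfolding t_first by (simp add: right_diff_distrib exp_minus)
      then show ?thesis using 0 by (simp add: f_def mult_ac)
    next
      case (Suc v)
      have "real w * f w - l * f (w + 1) = exp (- l) * (real (Suc v) * suminf (t v) - l * suminf (t (Suc v)))"
        by (simp add: Suc f_def algebra_simps)
      then show ?thesis using t_step[of v] Suc by simp
    qed
  qed
qed

text \<open>For \<open>n \<ge> 2\<close> this is the probability that \<open>mj n \<pi>\<close>
  exceeds \<open>d\<close>, by \<open>less_mj_iff\<close>.\<close>

definition avoid_prob :: "nat \<Rightarrow> nat \<Rightarrow> real" where
  "avoid_prob d n = (\<Sum>\<pi>\<in>perms n. of_bool (num_close d n \<pi> = 0)) / fact n"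

lemma avoid_prob_nonneg: "0 \<le> avoid_prob d n"
  unfolding avoid_prob_def by (intro divide_nonneg_nonneg sum_nonneg) auto

lemma avoid_prob_0: "avoid_prob 0 n = 1"
proof -
  have "close_pos 0 n \<pi> = {}" for \<pi>
    by (auto simp: close_pos_def close_def)
  then show ?thesis by (simp add: avoid_prob_def num_close_def card_perms)
qed

text \<open>Summing Stein's equation over all permutations turns its right side into
  \<open>n!\<close> times the difference of the two probabilities, so the error is at most
  \<open>K / n\<close>. The case \<open>d = 0\<close> is separate because the Stein solution is for
  positive mean.\<close>

lemma avoid_prob_tendsto: "(\<lambda>n. avoid_prob d n) \<longlonglongrightarrow> exp (- 2 * real d)"
proof (cases "d = 0")
  case True
  then show ?thesis by (simp add: avoid_prob_0)
next
  case False
  then have "2 * real d > 0" by simp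
  then obtain f :: "nat \<Rightarrow> real" where f: "\<And>w. 0 \<le> f w" "\<And>w. f w \<le> 1"
    and eq: "\<And>w. real w * f w - 2 * real d * f (w + 1) = exp (- (2 * real d)) - of_bool (w = 0)"
    by (rule stein_solution) blast
  define K where "K = 2 * real d * (2 * real d + 1) + 4 * real d * (10 * real d + 7)
      + 32 * real d * (real d + 2)"
  have bound: "\<bar>avoid_prob d n - exp (- 2 * real d)\<bar> \<le> K / real n" if n: "n \<ge> 2" for n
  proof -
    have "(\<Sum>\<pi>\<in>perms n. real (num_close d n \<pi>) * f (num_close d n \<pi>)
            - 2 * real d * f (num_close d n \<pi> + 1))
        = fact n * (exp (- 2 * real d) - avoid_prob d n)"
      unfolding eq by (simp add: sum_subtractf avoid_prob_def card_perms right_diff_distrib del: sum_of_bool_eq)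
    then have "real n * \<bar>fact n * (exp (- 2 * real d) - avoid_prob d n)\<bar> \<le> K * fact n"
      using stein_error_bound[of f n d, OF f n] unfolding K_def by simp
    then have "fact n * (real n * \<bar>avoid_prob d n - exp (- 2 * real d)\<bar>) \<le> fact n * K"
      by (simp add: abs_mult abs_minus_commute mult_ac)
    then have "real n * \<bar>avoid_prob d n - exp (- 2 * real d)\<bar> \<le> K"
      by (rule mult_left_le_imp_le) simp
    then show ?thesis using n by (simp add: field_simps)
  qed
  have "(\<lambda>n. avoid_prob d n - exp (- 2 * real d)) \<longlonglongrightarrow> 0"
  proof (rule Lim_null_comparison)
    show "\<forall>\<^sub>F n in sequentially. norm (avoid_prob d n - exp (- 2 * real d)) \<le> K / real n"
      using eventually_ge_at_top[of 2] by eventually_elim (use bound in auto)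
    show "(\<lambda>n. K / real n) \<longlonglongrightarrow> 0" by (rule lim_const_over_n)
  qed
  then show ?thesis by (simp add: LIM_zero_iff)
qed

subsection \<open>Tail bound\<close>

text \<open>A permutation with at most \<open>k\<close> close positions has at least
  \<open>d * (n - 1)\<close> swaps that make \<open>p\<close> close, each leading to at most
  \<open>k + 4\<close> close positions. Conversely, a permutation of the latter kind is reached at
  most \<open>n * (k + 4)\<close> times.\<close>

lemma avoid_step:
  assumes "n \<ge> 2" "d < n"
  shows "real d * (\<Sum>\<pi>\<in>perms n. of_bool (num_close d n \<pi> \<le> k))
       \<le> 2 * real (k + 4) * (\<Sum>\<pi>\<in>perms n. of_bool (num_close d n \<pi> \<le> k + 4))"
proof -
  define N where "N = num_close d n"
  let ?Q = "\<lambda>k. \<Sum>\<pi>\<in>perms n. of_bool (N \<pi> \<le> k) :: real"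
  let ?u = "\<lambda>\<pi> p q. of_bool (p \<in> close_pos d n (swap \<pi> p q)) :: real"
  have "real d * (real n - 1) * ?Q k = (\<Sum>\<pi>\<in>perms n. real d * (real n - 1) * of_bool (N \<pi> \<le> k))"
    by (simp only: sum_distrib_left)
  also have "\<dots> \<le> (\<Sum>\<pi>\<in>perms n. (\<Sum>p\<in>{1..<n}. \<Sum>q\<in>{1..n}. ?u \<pi> p q) * of_bool (N \<pi> \<le> k))"
  proof (intro sum_mono mult_right_mono)
    fix \<pi> assume "\<pi> \<in> perms n"
    then have \<pi>: "\<pi> permutes {1..n}" by simp
    show "real d * (real n - 1) \<le> (\<Sum>p\<in>{1..<n}. \<Sum>q\<in>{1..n}. ?u \<pi> p q)"
      unfolding sum_pq_close_pos_swap[OF \<pi>] using sum_deg_ge[OF \<pi> assms(2)] by simp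
  qed auto
  also have "\<dots> = (\<Sum>\<pi>\<in>perms n. \<Sum>p\<in>{1..<n}. \<Sum>q\<in>{1..n}. ?u \<pi> p q * of_bool (N \<pi> \<le> k))"
    by (simp only: sum_distrib_right)
  also have "\<dots> \<le> (\<Sum>\<pi>\<in>perms n. \<Sum>p\<in>{1..<n}. \<Sum>q\<in>{1..n}. ?u \<pi> p q * of_bool (N (swap \<pi> p q) \<le> k + 4))"
  proof (intro sum_mono mult_left_mono)
    fix \<pi> p q
    show "of_bool (N \<pi> \<le> k) \<le> (of_bool (N (swap \<pi> p q) \<le> k + 4) :: real)"
      using num_close_swap_le[of d n \<pi> p q] by (auto simp: N_def simp del: o_apply)
  qed auto
  also have "\<dots> = (\<Sum>\<pi>\<in>perms n. real n * real (N \<pi>) * of_bool (N \<pi> \<le> k + 4))"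
    unfolding N_def by (rule sum_perms_exchange[symmetric])
  also have "\<dots> \<le> (\<Sum>\<pi>\<in>perms n. real n * real (k + 4) * of_bool (N \<pi> \<le> k + 4))"
    by (intro sum_mono) (auto intro!: mult_left_mono)
  also have "\<dots> = real n * real (k + 4) * ?Q (k + 4)"
    by (simp only: sum_distrib_left)
  also have "\<dots> \<le> (2 * (real n - 1)) * real (k + 4) * ?Q (k + 4)"
    using assms by (intro mult_right_mono sum_nonneg) auto
  finally have "(real n - 1) * (real d * ?Q k) \<le> (real n - 1) * (2 * real (k + 4) * ?Q (k + 4))"
    by (simp only: mult_ac)
  then show ?thesis unfolding N_def
    by (rule mult_left_le_imp_le) (use assms in auto)
qed

text \<open>Each further power of \<open>d\<close> is bought by raising \<open>k\<close> by 4, hence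
  the induction with \<open>k\<close> arbitrary. The constant depends on \<open>r\<close> and
  \<open>k\<close> only.\<close>

lemma avoid_iterate:
  "\<exists>C\<ge>0. \<forall>n\<ge>2. \<forall>d<n. real d ^ r * (\<Sum>\<pi>\<in>perms n. of_bool (num_close d n \<pi> \<le> k)) \<le> C * fact n"
proof (induction r arbitrary: k)
  case 0
  have "(\<Sum>\<pi>\<in>perms n. of_bool (num_close d n \<pi> \<le> k) :: real) \<le> (\<Sum>\<pi>\<in>perms n. 1)" for n d
    by (intro sum_mono) auto
  then show ?case by (intro exI[of _ 1]) (simp add: card_perms del: sum_of_bool_eq)
next
  case (Suc r)
  obtain C where C: "C \<ge> 0"
    "\<And>n d. n \<ge> 2 \<Longrightarrow> d < n \<Longrightarrow>
       real d ^ r * (\<Sum>\<pi>\<in>perms n. of_bool (num_close d n \<pi> \<le> k + 4)) \<le> C * fact n"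
    using Suc.IH[of "k + 4"] by blast
  show ?case
  proof (intro exI[of _ "2 * real (k + 4) * C"] conjI allI impI)
    show "0 \<le> 2 * real (k + 4) * C" using C(1) by simp
    fix n d :: nat assume nd: "n \<ge> 2" "d < n"
    let ?Q = "\<lambda>k. \<Sum>\<pi>\<in>perms n. of_bool (num_close d n \<pi> \<le> k) :: real"
    have "real d ^ Suc r * ?Q k = real d ^ r * (real d * ?Q k)" by (simp only: power_Suc mult_ac)
    also have "\<dots> \<le> real d ^ r * (2 * real (k + 4) * ?Q (k + 4))"
      by (intro mult_left_mono avoid_step nd) auto
    also have "\<dots> = 2 * real (k + 4) * (real d ^ r * ?Q (k + 4))" by (simp only: mult_ac)
    also have "\<dots> \<le> 2 * real (k + 4) * (C * fact n)"
      by (intro mult_left_mono C(2) nd) auto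
    finally show "real d ^ Suc r * ?Q k \<le> 2 * real (k + 4) * C * fact n" by (simp only: mult_ac)
  qed
qed

lemma num_close_pos:
  assumes "\<pi> permutes {1..n}" "n \<ge> 2" "d \<ge> n"
  shows "num_close d n \<pi> > 0"
proof -
  have "\<pi> 1 \<in> {1..n}" "\<pi> 2 \<in> {1..n}"
    using assms permutes_in_image[OF assms(1)] by (metis atLeastAtMost_iff le_refl one_le_numeral order.trans)+
  moreover have "\<pi> 1 \<noteq> \<pi> 2"
    using permutes_inj[OF assms(1)] by (simp add: inj_eq)
  ultimately have "1 \<in> close_pos d n \<pi>"
    using assms by (auto simp: close_pos_def close_def numeral_2_eq_2)
  then show ?thesis unfolding num_close_def by (auto simp: card_gt_0_iff)
qed

lemma avoid_prob_eq_0: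
  assumes "n \<ge> 2" "d \<ge> n"
  shows "avoid_prob d n = 0"
proof -
  have "(\<Sum>\<pi>\<in>perms n. of_bool (num_close d n \<pi> = 0) :: real) = (\<Sum>\<pi>\<in>perms n. 0)"
    using num_close_pos[OF _ assms] by (intro sum.cong) auto
  then show ?thesis by (simp add: avoid_prob_def del: sum_of_bool_eq)
qed

lemma avoid_prob_tail:
  "\<exists>C\<ge>0. \<forall>n\<ge>2. \<forall>d. real (Suc d) ^ r * avoid_prob d n \<le> C"
proof -
  obtain C where C: "C \<ge> 0"
    "\<And>n d. n \<ge> 2 \<Longrightarrow> d < n \<Longrightarrow>
       real d ^ r * (\<Sum>\<pi>\<in>perms n. of_bool (num_close d n \<pi> \<le> 0)) \<le> C * fact n"
    using avoid_iterate[of r 0] by blast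
  \<comment> \<open>Passing from \<open>d\<close> to \<open>Suc d\<close> costs the factor
    \<open>2 ^ r\<close> for positive \<open>d\<close>. The summand 1 covers \<open>d = 0\<close>,
    where the probability is 1; for \<open>d \<ge> n\<close> it vanishes.\<close>
  have "real (Suc d) ^ r * avoid_prob d n \<le> 2 ^ r * C + 1" if n: "n \<ge> 2" for n d
  proof (cases "d = 0 \<or> d \<ge> n")
    case True
    then show ?thesis using avoid_prob_eq_0[OF n, of d] C(1) by (auto simp: avoid_prob_0)
  next
    case False
    then have "real d ^ r * (\<Sum>\<pi>\<in>perms n. of_bool (num_close d n \<pi> = 0)) \<le> C * fact n"
      using C(2)[OF n, of d] by (simp del: sum_of_bool_eq)
    then have *: "real d ^ r * avoid_prob d n \<le> C"
      by (simp add: avoid_prob_def field_simps del: sum_of_bool_eq)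
    have "real (Suc d) ^ r * avoid_prob d n \<le> (2 * real d) ^ r * avoid_prob d n"
      using False by (intro mult_right_mono power_mono avoid_prob_nonneg) auto
    also have "\<dots> = 2 ^ r * (real d ^ r * avoid_prob d n)" by (simp add: power_mult_distrib)
    also have "\<dots> \<le> 2 ^ r * C" by (intro mult_left_mono *) auto
    finally show ?thesis by simp
  qed
  then show ?thesis using C(1) by (intro exI[of _ "2 ^ r * C + 1"]) auto
qed

subsection \<open>Convergence of moments\<close>

text \<open>Adjacent entries of a permutation differ, so being not close means being more than
  \<open>d\<close> apart; \<open>n \<ge> 2\<close> makes the minimum range over a nonempty
  set.\<close>

lemma less_mj_iff:
  assumes "\<pi> permutes {1..n}" "n \<ge> 2"
  shows "d < mj n \<pi> \<longleftrightarrow> num_close d n \<pi> = 0"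
proof -
  have "d < mj n \<pi> \<longleftrightarrow> (\<forall>i\<in>{1..n - 1}. d < nat \<bar>int (\<pi> (i + 1)) - int (\<pi> i)\<bar>)"
    unfolding mj_def using assms(2) by (subst Min_gr_iff) auto
  also have "\<dots> \<longleftrightarrow> (\<forall>i\<in>{1..<n}. \<not> close d (\<pi> i) (\<pi> (Suc i)))"
  proof (intro ball_cong)
    fix i assume "i \<in> {1..<n}"
    have "\<pi> i \<noteq> \<pi> (Suc i)" using permutes_inj[OF assms(1)] by (simp add: inj_eq)
    then show "d < nat \<bar>int (\<pi> (i + 1)) - int (\<pi> i)\<bar> \<longleftrightarrow> \<not> close d (\<pi> i) (\<pi> (Suc i))"
      by (auto simp: close_def)
  qed (use assms in auto)
  also have "\<dots> \<longleftrightarrow> num_close d n \<pi> = 0"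
    unfolding num_close_def by (auto simp: close_pos_def card_eq_0_iff)
  finally show ?thesis .
qed

text \<open>The weights of the summation by parts, which expresses moments through tail
  probabilities.\<close>

definition power_diff :: "nat \<Rightarrow> nat \<Rightarrow> real" where
  "power_diff a d = real (Suc d) ^ a - real d ^ a"

lemma power_diff_nonneg: "0 \<le> power_diff a d"
  by (simp add: power_diff_def power_mono)

lemma power_diff_le: "power_diff a d \<le> real (Suc d) ^ a"
  by (simp add: power_diff_def)

lemma sum_power_diff: "0 ^ a + (\<Sum>d<m. power_diff a d) = real m ^ a"
  unfolding power_diff_def using sum_lessThan_telescope[of "\<lambda>d. real d ^ a" m] by simp

text \<open>Telescoping up to \<open>mj n \<pi>\<close>, extended to \<open>n\<close> by indicators.
  The summand \<open>0 ^ a\<close> is the value at 0 and equals 1 exactly for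
  \<open>a = 0\<close>.\<close>

lemma mj_power:
  assumes "\<pi> permutes {1..n}" "n \<ge> 2"
  shows "real (mj n \<pi>) ^ a = 0 ^ a + (\<Sum>d<n. power_diff a d * of_bool (num_close d n \<pi> = 0))"
proof -
  have "mj n \<pi> \<le> n"
    using less_mj_iff[OF assms, of n] num_close_pos[OF assms, of n] by force
  then have "(\<Sum>d<mj n \<pi>. power_diff a d) = (\<Sum>d<n. power_diff a d * of_bool (d < mj n \<pi>))"
    by (intro sum.mono_neutral_cong_left) auto
  then show ?thesis using sum_power_diff[of a "mj n \<pi>"] less_mj_iff[OF assms] by simp
qed

lemma Zn_moment_eq:
  assumes "n \<ge> 2"
  shows "Zn_moment a n = 0 ^ a + (\<Sum>d. power_diff a d * avoid_prob d n)"
proof -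
  have ne: "perms n \<noteq> {}" using permutes_id by blast
  have "Zn_moment a n = (\<Sum>\<pi>\<in>perms n. real (mj n \<pi>) ^ a) / fact n"
    unfolding Zn_moment_def by (subst integral_pmf_of_set[OF ne finite_perms]) (simp add: card_perms)
  also have "(\<Sum>\<pi>\<in>perms n. real (mj n \<pi>) ^ a)
      = (\<Sum>\<pi>\<in>perms n. 0 ^ a + (\<Sum>d<n. power_diff a d * of_bool (num_close d n \<pi> = 0)))"
    using mj_power[OF _ assms] by (intro sum.cong) auto
  also have "\<dots> = fact n * 0 ^ a + (\<Sum>d<n. \<Sum>\<pi>\<in>perms n. power_diff a d * of_bool (num_close d n \<pi> = 0))"
    unfolding sum.distrib by (subst sum.swap) (simp add: card_perms del: sum_of_bool_mult_eq sum_of_bool_eq)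
  also have "\<dots> = fact n * 0 ^ a + (\<Sum>d<n. power_diff a d * (fact n * avoid_prob d n))"
    unfolding avoid_prob_def sum_distrib_left[symmetric] by simp
  also have "\<dots> = fact n * (0 ^ a + (\<Sum>d<n. power_diff a d * avoid_prob d n))"
    by (simp add: algebra_simps sum_distrib_left)
  \<comment> \<open>An infinite range independent of \<open>n\<close> is the form to which Tannery's
    theorem applies.\<close>
  also have "(\<Sum>d<n. power_diff a d * avoid_prob d n) = (\<Sum>d. power_diff a d * avoid_prob d n)"
    using avoid_prob_eq_0[OF assms] by (intro suminf_finite[symmetric]) auto
  finally show ?thesis by simp
qed

text \<open>The tail bound with exponent \<open>a + 2\<close> leaves the summable majorant
  \<open>C / (d + 1)\<^sup>2\<close>, uniformly in \<open>n \<ge> 2\<close>. Tannery's theorem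
  yields both the limit and the summability of the limiting series.\<close>

lemma Zn_moment_tendsto:
  "Zn_moment a \<longlonglongrightarrow> 0 ^ a + (\<Sum>d. power_diff a d * exp (- 2 * real d))"
  and summable_power_diff_exp: "summable (\<lambda>d. power_diff a d * exp (- 2 * real d))"
proof -
  obtain C where C: "C \<ge> 0" "\<And>n d. n \<ge> 2 \<Longrightarrow> real (Suc d) ^ (a + 2) * avoid_prob d n \<le> C"
    using avoid_prob_tail[of "a + 2"] by blast
  define M where "M = (\<lambda>d. C * inverse (real (Suc d) ^ 2))"
  have M: "summable M" unfolding M_def
    by (intro summable_mult) (subst summable_Suc_iff, rule inverse_power_summable, simp)
  have bound: "norm (power_diff a d * avoid_prob d n) \<le> M d" if "n \<ge> 2" for n d
  proof -
    have "norm (power_diff a d * avoid_prob d n) = power_diff a d * avoid_prob d n"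
      by (simp add: power_diff_nonneg avoid_prob_nonneg)
    also have "\<dots> \<le> real (Suc d) ^ a * avoid_prob d n"
      by (intro mult_right_mono power_diff_le avoid_prob_nonneg)
    also have "\<dots> = (real (Suc d) ^ (a + 2) * avoid_prob d n) * inverse (real (Suc d) ^ 2)"
      by (simp add: power_add field_simps power2_eq_square del: of_nat_Suc)
    also have "\<dots> \<le> M d" unfolding M_def by (intro mult_right_mono C that) auto
    finally show ?thesis .
  qed
  have ev: "eventually (\<lambda>(d, n). norm (power_diff a d * avoid_prob d n) \<le> M d) (at_top \<times>\<^sub>F sequentially)"
  proof -
    have "eventually (\<lambda>x. snd x \<ge> (2::nat)) ((at_top :: nat filter) \<times>\<^sub>F sequentially)"
      by (rule eventually_compose_filterlim[OF eventually_ge_at_top filterlim_snd])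
    then show ?thesis by eventually_elim (use bound in auto)
  qed
  have T: "eventually (\<lambda>n. summable (\<lambda>d. norm (power_diff a d * avoid_prob d n))) sequentially \<and>
      summable (\<lambda>d. norm (power_diff a d * exp (- 2 * real d))) \<and>
      (\<lambda>n. \<Sum>d. power_diff a d * avoid_prob d n) \<longlonglongrightarrow> (\<Sum>d. power_diff a d * exp (- 2 * real d))"
    by (rule tannerys_theorem[OF _ ev M])
      (rule tendsto_mult[OF tendsto_const avoid_prob_tendsto], simp)
  show "summable (\<lambda>d. power_diff a d * exp (- 2 * real d))"
    by (rule summable_norm_cancel) (rule T[THEN conjunct2, THEN conjunct1])
  have "(\<lambda>n. 0 ^ a + (\<Sum>d. power_diff a d * avoid_prob d n))
      \<longlonglongrightarrow> 0 ^ a + (\<Sum>d. power_diff a d * exp (- 2 * real d))"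
    by (rule tendsto_add[OF tendsto_const T[THEN conjunct2, THEN conjunct2]])
  then show "Zn_moment a \<longlonglongrightarrow> 0 ^ a + (\<Sum>d. power_diff a d * exp (- 2 * real d))"
  proof (rule Lim_transform_eventually)
    show "\<forall>\<^sub>F n in sequentially. 0 ^ a + (\<Sum>d. power_diff a d * avoid_prob d n) = Zn_moment a n"
      using eventually_ge_at_top[of 2] by eventually_elim (simp add: Zn_moment_eq)
  qed
qed

text \<open>Summation by parts for the limit law; the subtracted term is the boundary contribution,
  which vanishes as \<open>m\<close> grows.\<close>

lemma sum_Z_prob:
  "(\<Sum>d<Suc m. real d ^ a * Z_prob d)
     = 0 ^ a + (\<Sum>d<m. power_diff a d * exp (- 2 * real d)) - real m ^ a * exp (- 2 * real m)"
proof (induction m)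
  case 0
  then show ?case by (simp add: Z_prob_def)
next
  case (Suc m)
  then show ?case
    by (subst sum.lessThan_Suc) (simp add: Z_prob_def power_diff_def algebra_simps del: of_nat_Suc)
qed

lemma Z_moment_eq: "Z_moment a = 0 ^ a + (\<Sum>d. power_diff a d * exp (- 2 * real d))"
proof -
  have "(\<lambda>m. real m ^ a * exp (- 2 * real m)) \<longlonglongrightarrow> 0"
    by real_asymp
  then have "(\<lambda>m. 0 ^ a + (\<Sum>d<m. power_diff a d * exp (- 2 * real d)) - real m ^ a * exp (- 2 * real m))
      \<longlonglongrightarrow> 0 ^ a + (\<Sum>d. power_diff a d * exp (- 2 * real d)) - 0"
    by (intro tendsto_intros summable_LIMSEQ summable_power_diff_exp)
  then have "(\<lambda>m. \<Sum>d<m. real d ^ a * Z_prob d)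
      \<longlonglongrightarrow> 0 ^ a + (\<Sum>d. power_diff a d * exp (- 2 * real d))"
    unfolding sum_Z_prob[symmetric] by (subst (asm) filterlim_sequentially_Suc) simp
  then show ?thesis
    unfolding Z_moment_def by (intro sums_unique[symmetric]) (simp add: sums_def)
qed

theorem theorem4:
  shows "(\<forall>a::nat. (\<lambda>n. Zn_moment a n) \<longlonglongrightarrow> Z_moment a)
       \<and> (\<lambda>n. measure_pmf.expectation (pmf_of_set {\<pi>. \<pi> permutes {1..n}})
                 (\<lambda>\<pi>. real (mj n \<pi>))) \<longlonglongrightarrow> (\<Sum>d. exp (-2 * real d))"
proof (intro conjI allI)
  show "Zn_moment a \<longlonglongrightarrow> Z_moment a" for a
    unfolding Z_moment_eq by (rule Zn_moment_tendsto)
  \<comment> \<open>For \<open>a = 1\<close> every weight \<open>power_diff 1 d\<close> is 1 and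
    \<open>0 ^ 1\<close> is 0, so only the tail probabilities remain.\<close>
  have "Zn_moment 1 \<longlonglongrightarrow> (\<Sum>d. exp (-2 * real d))"
    using Zn_moment_tendsto[of 1] by (simp add: power_diff_def)
  then show "(\<lambda>n. measure_pmf.expectation (pmf_of_set {\<pi>. \<pi> permutes {1..n}})
                 (\<lambda>\<pi>. real (mj n \<pi>))) \<longlonglongrightarrow> (\<Sum>d. exp (-2 * real d))"
    by (simp add: Zn_moment_def[abs_def])
qed

end
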